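(* Let $m \geq 2$ and let $G=\Theta(s_1, s_2, \ldots, s_m)$ be a generalized theta graph. Then $$m-3 \leq \beta(G) \leq m.$$
   Context: All graphs are simple, undirected, connected and finite; $d(u,v)$ is the shortest-path distance. A vertex $w$ resolves vertices $u,v$ if $d(u,w)\neq d(v,w)$. A set $W\subseteq V(G)$ is a resolving set if every pair of distinct vertices of $G$ is resolved by some vertex of $W$; the metric dimension $\beta(G)$ is the minimum cardinality of a resolving set. For positive integers $m$ and $s_1\le s_2\le\cdots\le s_m$, the generalized theta graph $\Theta(s_1,\ldots,s_m)$ consists of two vertices $c_1,c_2$ (the centers) joined by $m$ internally disjoint paths $P_1,\ldots,P_m$, where $P_i$ has length $s_i+1$ (i.e. $s_i$ internal vertices); $m$ is the multiplicity. *)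

theory Defs
  imports "Graph_Theory.Graph_Theory"
begin

text \<open>A simple undirected finite graph is a symmetric, loop-free finite digraph without parallel
  arcs (locale \<^locale>\<open>graph\<close>). The distance is the library's minimal walk cost with every arc having
  cost 1; since it is an extended real, it is meaningful for all pairs of vertices.\<close>

definition graph_dist :: "('a, 'b) pre_digraph \<Rightarrow> 'a \<Rightarrow> 'a \<Rightarrow> ereal" where
  "graph_dist G u v = wf_digraph.\<mu> G (\<lambda>_. 1) u v"

definition resolves :: "('a, 'b) pre_digraph \<Rightarrow> 'a \<Rightarrow> 'a \<Rightarrow> 'a \<Rightarrow> bool" where
  "resolves G w u v \<longleftrightarrow> graph_dist G u w \<noteq> graph_dist G v w"

definition resolving_set :: "('a, 'b) pre_digraph \<Rightarrow> 'a set \<Rightarrow> bool" where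
  "resolving_set G W \<longleftrightarrow> W \<subseteq> verts G \<and>
     (\<forall>u \<in> verts G. \<forall>v \<in> verts G. u \<noteq> v \<longrightarrow> (\<exists>w \<in> W. resolves G w u v))"

text \<open>For a finite graph the whole vertex set is a finite resolving set, so the minimum exists.\<close>

definition metric_dimension :: "('a, 'b) pre_digraph \<Rightarrow> nat" where
  "metric_dimension G = (LEAST k. \<exists>W. finite W \<and> resolving_set G W \<and> card W = k)"

lemma resolving_set_verts:
  assumes "graph G"
  shows "resolving_set G (verts G)"
proof -
  interpret graph G by fact
  have self: "graph_dist G w w = 0" if w: "w \<in> verts G" for w
  proof -
    have "awalk w [] w" using w by (simp add: awalk_Nil_iff)
    from min_cost_le_walk_cost[OF this, of "\<lambda>_. 1"]
    have le: "graph_dist G w w \<le> 0" by (simp add: graph_dist_def zero_ereal_def)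
    have ge: "0 \<le> graph_dist G w w"
      unfolding graph_dist_def \<mu>_def by (rule INF_greatest) (simp add: pos_cost_pos_awalk_cost)
    show ?thesis using le ge by (rule antisym)
  qed
  have pos: "graph_dist G u w \<noteq> 0" if ne: "u \<noteq> w" for u w
  proof -
    have "1 \<le> graph_dist G u w"
      unfolding graph_dist_def \<mu>_def
    proof (rule INF_greatest)
      fix p assume "p \<in> {p. awalk u p w}"
      then have p: "awalk u p w" by simp
      with ne obtain e q where "p = e # q" by (cases p) (auto simp: awalk_Nil_iff)
      moreover have "0 \<le> awalk_cost (\<lambda>_. 1) q"
        unfolding awalk_cost_def by (rule sum_list_nonneg) auto
      ultimately show "1 \<le> ereal (awalk_cost (\<lambda>_. 1) p)" by simp
    qed
    then show ?thesis by auto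
  qed
  show ?thesis unfolding resolving_set_def resolves_def by (metis self pos order_refl)
qed

datatype theta_vertex = Center1 | Center2 | Internal nat nat

text \<open>\<open>theta_path s i j\<close> is the vertex at position \<open>j\<close> of the \<open>i\<close>-th path (paths are numbered from 0),
  which runs from \<open>Center1\<close> at position 0 to \<open>Center2\<close> at position \<open>s ! i + 1\<close>.\<close>

definition theta_path :: "nat list \<Rightarrow> nat \<Rightarrow> nat \<Rightarrow> theta_vertex" where
  "theta_path s i j =
     (if j = 0 then Center1 else if j = s ! i + 1 then Center2 else Internal i j)"

definition generalized_theta :: "nat list \<Rightarrow> theta_vertex pair_pre_digraph" where
  "generalized_theta s =
     \<lparr> pverts = {Center1, Center2} \<union> {Internal i j | i j. i < length s \<and> 1 \<le> j \<and> j \<le> s ! i},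
       parcs = {(theta_path s i j, theta_path s i (j + 1)) | i j. i < length s \<and> j \<le> s ! i} \<union>
               {(theta_path s i (j + 1), theta_path s i j) | i j. i < length s \<and> j \<le> s ! i} \<rparr>"

lemma generalized_theta_graph: "pair_graph (generalized_theta s)"
proof -
  let ?G = "generalized_theta s"
  have wf: "pair_wf_digraph ?G"
    by unfold_locales (auto simp: generalized_theta_def theta_path_def split: if_splits)
  have fin: "finite (pverts ?G)"
  proof -
    have "{Internal i j | i j. i < length s \<and> 1 \<le> j \<and> j \<le> s ! i}
        = (\<Union>i<length s. Internal i ` {1..s ! i})" by auto
    then have "finite {Internal i j | i j. i < length s \<and> 1 \<le> j \<and> j \<le> s ! i}"
      by (simp only:) blast
    then show ?thesis by (simp add: generalized_theta_def)
  qed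
  have "parcs ?G \<subseteq> pverts ?G \<times> pverts ?G"
    using pair_wf_digraph.wellformed'[OF wf] by auto
  then have fina: "finite (parcs ?G)" using fin by (meson finite_SigmaI finite_subset)
  have sym: "symmetric (with_proj ?G)"
    unfolding symmetric_def by (auto simp: generalized_theta_def intro!: symI)
  have loop: "fst e \<noteq> snd e" if "e \<in> parcs ?G" for e
    using that by (auto simp: generalized_theta_def theta_path_def split: if_splits)
  from wf fin fina sym loop show ?thesis
    by (simp add: pair_graph_def pair_digraph_def pair_pseudo_graph_def pair_fin_digraph_def
        pair_fin_digraph_axioms_def pair_sym_digraph_def pair_sym_digraph_axioms_def
        pair_loopfree_digraph_def pair_loopfree_digraph_axioms_def)
qed

lemma generalized_theta_connected:
  assumes "s \<noteq> []"
  shows "strongly_connected (with_proj (generalized_theta s))"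
proof -
  let ?G = "generalized_theta s"
  interpret pair_graph ?G by (rule generalized_theta_graph)
  have path: "Center1 \<rightarrow>\<^sup>*\<^bsub>with_proj ?G\<^esub> theta_path s i j" if "i < length s" "j \<le> s ! i + 1" for i j
    using that(2)
  proof (induction j)
    case 0
    have "Center1 \<in> pverts ?G" by (simp add: generalized_theta_def)
    then show ?case by (simp add: theta_path_def)
  next
    case (Suc j)
    then have "(theta_path s i j, theta_path s i (Suc j)) \<in> parcs ?G"
      using that(1) unfolding generalized_theta_def pair_pre_digraph.simps
      by (intro UnI1 CollectI exI[of _ i] exI[of _ j]) simp
    then show ?case using Suc by (auto intro: reachable_adj_trans)
  qed
  have reach: "Center1 \<rightarrow>\<^sup>*\<^bsub>with_proj ?G\<^esub> v" if v: "v \<in> pverts ?G" for v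
  proof (cases v)
    case Center1
    then show ?thesis using path[of 0 0] assms by (simp add: theta_path_def)
  next
    case Center2
    then show ?thesis using path[of 0 "s ! 0 + 1"] assms by (simp add: theta_path_def)
  next
    case (Internal i j)
    then show ?thesis using path[of i j] v by (simp add: theta_path_def generalized_theta_def)
  qed
  have "u \<rightarrow>\<^sup>*\<^bsub>with_proj ?G\<^esub> v" if u: "u \<in> pverts ?G" and v: "v \<in> pverts ?G" for u v
  proof -
    have "u \<rightarrow>\<^sup>*\<^bsub>with_proj ?G\<^esub> Center1"
      using pair_sym_arcs reach[OF u] by (rule symmetric_reachable)
    then show ?thesis using reach[OF v] by (rule reachable_trans)
  qed
  moreover have "Center1 \<in> pverts ?G" by (simp add: generalized_theta_def)
  ultimately show ?thesis unfolding strongly_connected_def with_proj_simps by blast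
qed

end

theory Submission
  imports Defs
begin

text \<open>Let \<open>L i\<close> be the length of the \<open>i\<close>-th path, so that the centres are at distance \<open>L 0\<close>.
  Lower bound: at least four paths contain no interior vertex of a resolving set with at most
  \<open>m - 4\<close> elements. As seen from outside, the neighbour of \<open>Center1\<close> on such a path depends only
  on whether \<open>L i\<close> is \<open>L 0\<close>, \<open>L 0 + 1\<close> or larger, so two of the four neighbours are not resolved.
  Upper bound: take \<open>Center1\<close> and the midpoint of every path except the shortest. A midpoint is
  nearer to the interior of its own path than to any vertex outside that path other than
  \<open>Center1\<close>. Two interior vertices of a path at the same distance from its midpoint are told apart
  by \<open>Center1\<close>, and so are the vertices of the shortest path.\<close>

section \<open>Unit-cost distances as walk lengths\<close>

context fin_digraph
begin

lemma awalk_cost_unit: "awalk_cost (\<lambda>_. 1) p = real (length p)"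
  by (induct p) auto

lemma graph_dist_le_length: "awalk u p v \<Longrightarrow> graph_dist G u v \<le> ereal (real (length p))"
  using min_cost_le_walk_cost[of u p v "\<lambda>_. 1"] by (simp add: graph_dist_def awalk_cost_unit)

text \<open>Unit costs exclude negative cycles, so the infimum over all walks is reached by a
  path.\<close>

lemma graph_dist_attained:
  assumes "u \<rightarrow>\<^sup>* v"
  obtains p where "awalk u p v" "graph_dist G u v = ereal (real (length p))"
proof -
  have "\<exists>p. apath u p v \<and> \<mu> (\<lambda>_. 1) u v = awalk_cost (\<lambda>_. 1) p"
    using assms by (rule no_neg_cyc_reach_imp_path) (auto simp: awalk_cost_unit)
  then show thesis using that by (auto simp: graph_dist_def awalk_cost_unit apath_def)
qed

lemma lipschitz_awalk:
  fixes f :: "'a \<Rightarrow> real"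
  assumes "\<And>e. e \<in> arcs G \<Longrightarrow> f (tail G e) - f (head G e) \<le> 1"
  shows "awalk u p v \<Longrightarrow> f u - f v \<le> real (length p)"
proof (induct p arbitrary: u)
  case Nil
  then show ?case by (simp add: awalk_Nil_iff)
next
  case (Cons e p)
  then have e: "e \<in> arcs G" "u = tail G e" and p: "awalk (head G e) p v"
    by (auto simp: awalk_Cons_iff)
  from Cons.hyps[OF p] assms[OF e(1)] show ?case by (simp add: e(2))
qed

end

section \<open>Real-valued distance on theta graphs\<close>

locale sorted_theta =
  fixes s :: "nat list"
  assumes nonempty: "s \<noteq> []"
    and sorted: "sorted s"
    and positive: "\<And>i. i < length s \<Longrightarrow> s ! i \<ge> 1"
begin

abbreviation G where "G \<equiv> with_proj (generalized_theta s)"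
abbreviation P where "P \<equiv> theta_path s"
definition L where "L i = s ! i + 1"
text \<open>A real version suited to linear arithmetic. The value 0 that
  \<open>real_of_ereal\<close> gives at infinity never arises between vertices, because the graph is
  connected.\<close>

definition \<delta> where "\<delta> u v = real_of_ereal (graph_dist G u v)"

sublocale pair_graph "generalized_theta s"
  by (rule generalized_theta_graph)

lemma L_ge_2: "i < length s \<Longrightarrow> 2 \<le> L i"
  using positive[of i] by (simp add: L_def)

lemma L_0_le: "i < length s \<Longrightarrow> L 0 \<le> L i"
  using sorted by (simp add: L_def sorted_nth_mono)

lemma P_0: "P i 0 = Center1"
  by (simp add: theta_path_def)

lemma P_L: "P i (L i) = Center2"
  by (simp add: theta_path_def L_def)

lemma P_Internal: "0 < j \<Longrightarrow> j < L i \<Longrightarrow> P i j = Internal i j"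
  by (simp add: theta_path_def L_def)

lemma Center1_in_verts: "Center1 \<in> verts G"
  by (simp add: generalized_theta_def)

lemma Center2_in_verts: "Center2 \<in> verts G"
  by (simp add: generalized_theta_def)

lemma Internal_in_verts: "Internal i j \<in> verts G \<longleftrightarrow> i < length s \<and> 0 < j \<and> j < L i"
  by (auto simp: generalized_theta_def L_def)

lemma P_in_verts: "i < length s \<Longrightarrow> j \<le> L i \<Longrightarrow> P i j \<in> verts G"
  by (auto simp: theta_path_def L_def generalized_theta_def)

lemma ex_dist_awalk:
  assumes "u \<in> verts G" "v \<in> verts G"
  obtains p where "awalk u p v" "graph_dist G u v = ereal (real (length p))"
proof -
  have "u \<rightarrow>\<^sup>*\<^bsub>G\<^esub> v"
    using generalized_theta_connected[OF nonempty] assms by (auto simp: strongly_connected_def)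
  then show thesis using that by (rule graph_dist_attained)
qed

lemma graph_dist_eq: "u \<in> verts G \<Longrightarrow> v \<in> verts G \<Longrightarrow> graph_dist G u v = ereal (\<delta> u v)"
  by (metis ex_dist_awalk \<delta>_def real_of_ereal.simps(1))

lemma ex_\<delta>_awalk:
  assumes "u \<in> verts G" "v \<in> verts G"
  obtains p where "awalk u p v" "\<delta> u v = real (length p)"
  using assms by (metis ex_dist_awalk \<delta>_def real_of_ereal.simps(1))

lemma \<delta>_le_length:
  assumes "awalk u p v"
  shows "\<delta> u v \<le> real (length p)"
proof -
  have "u \<in> verts G" "v \<in> verts G"
    using awalk_hd_in_verts[OF assms] awalk_last_in_verts[OF assms] by simp_all
  then show ?thesis
    using graph_dist_le_length[OF assms] graph_dist_eq[of u v] by simp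
qed

lemma resolves_iff:
  "w \<in> verts G \<Longrightarrow> u \<in> verts G \<Longrightarrow> v \<in> verts G \<Longrightarrow> resolves G w u v \<longleftrightarrow> \<delta> u w \<noteq> \<delta> v w"
  by (simp add: resolves_def graph_dist_eq del: with_proj_simps)

lemma \<delta>_self: "u \<in> verts G \<Longrightarrow> \<delta> u u = 0"
  using \<delta>_le_length[of u "[]" u] ex_\<delta>_awalk[of u u] by (force simp: awalk_Nil_iff)

lemma \<delta>_triangle:
  assumes "u \<in> verts G" "v \<in> verts G" "w \<in> verts G"
  shows "\<delta> u w \<le> \<delta> u v + \<delta> v w"
proof -
  obtain p where p: "awalk u p v" "\<delta> u v = real (length p)" using assms ex_\<delta>_awalk by blast
  obtain q where q: "awalk v q w" "\<delta> v w = real (length q)" using assms ex_\<delta>_awalk by blast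
  have "awalk u (p @ q) w" using p(1) q(1) by (rule awalk_appendI)
  from \<delta>_le_length[OF this] p q show ?thesis by simp
qed

lemma \<delta>_arc: "(u, v) \<in> parcs (generalized_theta s) \<Longrightarrow> \<delta> u v \<le> 1"
  using \<delta>_le_length[of u "[(u, v)]" v] arc_implies_awalk[of "(u, v)"] by simp

lemma P_arcs:
  assumes "i < length s" "j < L i"
  shows "(P i j, P i (Suc j)) \<in> parcs (generalized_theta s)"
    and "(P i (Suc j), P i j) \<in> parcs (generalized_theta s)"
proof -
  show "(P i j, P i (Suc j)) \<in> parcs (generalized_theta s)"
    unfolding generalized_theta_def pair_pre_digraph.simps
    using assms by (intro UnI1 CollectI exI[of _ i] exI[of _ j]) (simp add: L_def)
  then show "(P i (Suc j), P i j) \<in> parcs (generalized_theta s)"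
    by (metis arcs_symmetric)
qed

lemma parcsE:
  assumes "(u, v) \<in> parcs (generalized_theta s)"
  obtains i j where "i < length s" "j < L i" "u = P i j" "v = P i (Suc j)"
  | i j where "i < length s" "j < L i" "u = P i (Suc j)" "v = P i j"
  using assms by (auto simp: generalized_theta_def L_def less_Suc_eq_le)

text \<open>The source of all lower bounds on distances: the change of \<open>f\<close> telescopes
  along a shortest walk, so a suitable potential replaces an analysis of walks.\<close>

lemma \<delta>_ge_lipschitz:
  fixes f :: "theta_vertex \<Rightarrow> real"
  assumes "\<And>i j. i < length s \<Longrightarrow> j < L i \<Longrightarrow> \<bar>f (P i j) - f (P i (Suc j))\<bar> \<le> 1"
    and uv: "u \<in> verts G" "v \<in> verts G"
  shows "f u - f v \<le> \<delta> u v"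
proof -
  obtain p where p: "awalk u p v" "\<delta> u v = real (length p)" using uv ex_\<delta>_awalk by blast
  have "f a - f b \<le> 1" if "(a, b) \<in> parcs (generalized_theta s)" for a b
    using that by (rule parcsE) (use assms(1) in fastforce)+
  then have "f u - f v \<le> real (length p)"
    by (intro lipschitz_awalk[OF _ p(1)]) auto
  then show ?thesis by (simp add: p)
qed

text \<open>Distance from \<open>v\<close> changes by at most 1 along an edge and vanishes at
  \<open>v\<close>; as a potential it bounds \<open>\<delta> u v\<close> from below by
  \<open>\<delta> v u\<close>.\<close>

lemma \<delta>_sym:
  assumes uv: "u \<in> verts G" "v \<in> verts G"
  shows "\<delta> u v = \<delta> v u"
proof -
  have le: "\<delta> v u \<le> \<delta> u v" if uv: "u \<in> verts G" "v \<in> verts G" for u v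
  proof -
    have "\<delta> v u - \<delta> v v \<le> \<delta> u v"
    proof (rule \<delta>_ge_lipschitz[OF _ uv])
      fix i j assume ij: "i < length s" "j < L i"
      then show "\<bar>\<delta> v (P i j) - \<delta> v (P i (Suc j))\<bar> \<le> 1"
        using \<delta>_triangle[OF uv(2), of "P i j" "P i (Suc j)"]
          \<delta>_triangle[OF uv(2), of "P i (Suc j)" "P i j"]
          \<delta>_arc[OF P_arcs(1)[OF ij]] \<delta>_arc[OF P_arcs(2)[OF ij]]
          P_in_verts[of i j] P_in_verts[of i "Suc j"]
        by linarith
    qed
    then show ?thesis using \<delta>_self uv by simp
  qed
  from le[OF uv] le[OF uv(2,1)] show ?thesis by simp
qed

section \<open>Distances along paths and to the centres\<close>

lemma \<delta>_path_le:
  assumes "i < length s" "a \<le> b" "b \<le> L i"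
  shows "\<delta> (P i a) (P i b) \<le> real (b - a)"
  using assms(2,3)
proof (induct b rule: dec_induct)
  case base
  then show ?case using \<delta>_self[OF P_in_verts] assms(1) by simp
next
  case (step b)
  then show ?case
    using \<delta>_triangle[of "P i a" "P i b" "P i (Suc b)"] \<delta>_arc[OF P_arcs(1)[OF assms(1), of b]]
      P_in_verts[OF assms(1), of a] P_in_verts[OF assms(1), of b]
      P_in_verts[OF assms(1), of "Suc b"]
    by (simp add: Suc_diff_le del: with_proj_simps)
qed

text \<open>The function \<open>g\<close> below is a 1-Lipschitz candidate for the distance to \<open>w\<close>.\<close>

lemma \<delta>_outside:
  assumes i: "i < length s" and j: "j \<le> L i" and w: "w \<in> verts G" "\<And>k. w \<noteq> Internal i k"
  shows "\<delta> (P i j) w = min (real j + \<delta> Center1 w) (real (L i - j) + \<delta> Center2 w)"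
    (is "_ = ?m j")
proof (rule antisym)
  note C = Center1_in_verts Center2_in_verts
  have up: "\<delta> (P i j) Center1 \<le> real j" "\<delta> (P i j) Center2 \<le> real (L i - j)"
    using \<delta>_path_le[OF i, of 0 j] \<delta>_path_le[OF i, of j "L i"] j
      \<delta>_sym[OF C(1) P_in_verts[OF i j]]
    by (auto simp: P_0 P_L)
  show "\<delta> (P i j) w \<le> ?m j"
    using up \<delta>_triangle[OF P_in_verts[OF i j] C(1) w(1)]
      \<delta>_triangle[OF P_in_verts[OF i j] C(2) w(1)] by simp
  \<comment> \<open>These inequalities make the minimum at the two ends of path \<open>i\<close>
    equal to the distances from the centres, so the clauses of \<open>g\<close> agree there.\<close>
  have cc: "\<delta> Center1 w \<le> L i + \<delta> Center2 w" "\<delta> Center2 w \<le> L i + \<delta> Center1 w"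
    using \<delta>_path_le[OF i, of 0 "L i"] \<delta>_sym[OF C] \<delta>_triangle[OF C w(1)]
      \<delta>_triangle[OF C(2,1) w(1)] by (auto simp: P_0 P_L)
  define g where "g v = (case v of Internal k j \<Rightarrow> if k = i then ?m j else \<delta> v w | _ \<Rightarrow> \<delta> v w)" for v
  have gi: "g (P i j) = ?m j" if "j \<le> L i" for j
    using that cc by (auto simp: g_def theta_path_def L_def)
  have gk: "g (P k j) = \<delta> (P k j) w" if "k \<noteq> i" for j k
    using that by (auto simp: g_def theta_path_def)
  have "g (P i j) - g w \<le> \<delta> (P i j) w"
  proof (rule \<delta>_ge_lipschitz[OF _ P_in_verts[OF i j] w(1)])
    fix k l assume kl: "k < length s" "l < L k"
    show "\<bar>g (P k l) - g (P k (Suc l))\<bar> \<le> 1"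
    proof (cases "k = i")
      case True
      with kl have "real (L i - l) = real (L i - Suc l) + 1" by (simp add: Suc_diff_Suc)
      then show ?thesis using kl True by (simp add: gi min_def) linarith
    next
      case False
      have v: "P k l \<in> verts G" "P k (Suc l) \<in> verts G" using kl
        by (auto intro!: P_in_verts simp del: with_proj_simps)
      show ?thesis
        using \<delta>_triangle[OF v w(1)] \<delta>_triangle[OF v(2,1) w(1)]
          \<delta>_arc[OF P_arcs(1)[OF kl]] \<delta>_arc[OF P_arcs(2)[OF kl]]
        by (simp add: gk[OF False])
    qed
  qed
  moreover have "g w = 0"
    using w \<delta>_self[OF w(1)] by (cases w) (auto simp: g_def)
  ultimately show "?m j \<le> \<delta> (P i j) w" using gi[OF j] by simp
qed

lemma \<delta>_centers: "\<delta> Center1 Center2 = L 0"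
proof (rule antisym)
  have 0: "0 < length s" using nonempty by simp
  show "\<delta> Center1 Center2 \<le> L 0"
    using \<delta>_path_le[OF 0, of 0 "L 0"] by (simp add: P_0 P_L)
  \<comment> \<open>Position truncated at \<open>L 0\<close>: every path is at least that long, so
    all of them give \<open>Center2\<close> the value \<open>L 0\<close>.\<close>
  define f where "f v = (case v of Center1 \<Rightarrow> 0 | Center2 \<Rightarrow> real (L 0)
    | Internal i j \<Rightarrow> real (min j (L 0)))" for v
  have f: "f (P i j) = real (min j (L 0))" if "i < length s" "j \<le> L i" for i j
    using that L_0_le[of i] by (auto simp: f_def theta_path_def L_def)
  have "f Center2 - f Center1 \<le> \<delta> Center2 Center1"
    by (rule \<delta>_ge_lipschitz[OF _ Center2_in_verts Center1_in_verts]) (auto simp: f)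
  then show "L 0 \<le> \<delta> Center1 Center2"
    using \<delta>_sym[OF Center1_in_verts Center2_in_verts] by (simp add: f_def)
qed

lemma \<delta>_Center1:
  assumes "i < length s" "j \<le> L i"
  shows "\<delta> (P i j) Center1 = min j (L i - j + L 0)"
  using \<delta>_outside[OF assms Center1_in_verts] \<delta>_centers \<delta>_self[OF Center1_in_verts]
    \<delta>_sym[OF Center1_in_verts Center2_in_verts] by simp

lemma \<delta>_Center2:
  assumes "i < length s" "j \<le> L i"
  shows "\<delta> (P i j) Center2 = min (j + L 0) (L i - j)"
  using \<delta>_outside[OF assms Center2_in_verts] \<delta>_centers \<delta>_self[OF Center2_in_verts] by simp

subsection \<open>Lower bound\<close>

text \<open>Truncation at 2 leaves three classes. From excess 2 on, leaving the first vertex of the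
  path through \<open>Center2\<close> is never shorter than leaving through
  \<open>Center1\<close>.\<close>

definition excess where "excess i = min (L i - L 0) 2"

text \<open>Either the lengths agree, and so do the two minima, or both lengths are at least
  \<open>L 0 + 2\<close> and both minima equal \<open>1 + \<delta> Center1 w\<close>.\<close>

lemma \<delta>_first_eq:
  assumes i: "i < length s" and k: "k < length s" and eq: "excess i = excess k"
    and w: "w \<in> verts G" "\<And>l. w \<noteq> Internal i l" "\<And>l. w \<noteq> Internal k l"
  shows "\<delta> (P i 1) w = \<delta> (P k 1) w"
proof -
  have "\<delta> Center1 w \<le> real (L 0) + \<delta> Center2 w"
    using \<delta>_triangle[OF Center1_in_verts Center2_in_verts w(1)] \<delta>_centers by simp
  moreover have "\<delta> (P i 1) w = min (1 + \<delta> Center1 w) (real (L i - 1) + \<delta> Center2 w)"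
    using \<delta>_outside[OF i _ w(1,2), of 1] L_ge_2[OF i] by simp
  moreover have "\<delta> (P k 1) w = min (1 + \<delta> Center1 w) (real (L k - 1) + \<delta> Center2 w)"
    using \<delta>_outside[OF k _ w(1,3), of 1] L_ge_2[OF k] by simp
  moreover have "L i = L k \<or> (L 0 + 1 \<le> L i - 1 \<and> L 0 + 1 \<le> L k - 1)"
    using eq L_0_le[OF i] L_0_le[OF k] by (auto simp: excess_def min_def split: if_splits)
  ultimately show ?thesis by (auto simp: min_def)
qed

lemma resolving_set_card_ge:
  assumes W: "resolving_set G W" "finite W"
  shows "length s \<le> card W + 3"
proof (rule ccontr)
  assume "\<not> ?thesis"
  then have lt: "card W + 3 < length s" by simp
  define hit where "hit = {i. \<exists>j. Internal i j \<in> W}"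
  \<comment> \<open>Centres go to the dummy index 0; this can only enlarge the image, and an upper
    bound on \<open>card hit\<close> is all that is wanted.\<close>
  have sub: "hit \<subseteq> (\<lambda>w. case w of Internal i j \<Rightarrow> i | _ \<Rightarrow> 0) ` W"
    by (force simp: hit_def)
  then have fin: "finite hit" and "card hit \<le> card W"
    using W(2) by (auto intro: finite_subset surj_card_le)
  \<comment> \<open>Pigeonhole: at least four paths avoid \<open>W\<close>, but only three excess
    values exist.\<close>
  then have "3 < card ({..<length s} - hit)"
    using lt diff_card_le_card_Diff[OF fin, of "{..<length s}"] by simp
  moreover have "card (excess ` ({..<length s} - hit)) \<le> card {..2::nat}"
    by (rule card_mono) (auto simp: excess_def)
  ultimately have "\<not> inj_on excess ({..<length s} - hit)"
    by (metis card_atMost card_image eval_nat_numeral(3) numeral_2_eq_2 not_less)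
  then obtain i k where ik: "i < length s" "k < length s" "i \<notin> hit" "k \<notin> hit" "i \<noteq> k"
    "excess i = excess k"
    by (auto simp: inj_on_def)
  have v: "P i 1 \<in> verts G" "P k 1 \<in> verts G" "P i 1 \<noteq> P k 1"
    using ik L_ge_2[of i] L_ge_2[of k]
    by (auto simp: P_Internal Internal_in_verts simp del: with_proj_simps)
  then obtain w where w: "w \<in> W" "resolves G w (P i 1) (P k 1)"
    using W(1) unfolding resolving_set_def by blast
  moreover have "w \<in> verts G" using w W by (auto simp: resolving_set_def)
  moreover have "\<delta> (P i 1) w = \<delta> (P k 1) w"
    using w(1) ik \<open>w \<in> verts G\<close> by (intro \<delta>_first_eq) (auto simp: hit_def)
  ultimately show False using v resolves_iff by blast
qed

subsection \<open>Upper bound\<close>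

text \<open>Rounding down makes the half towards \<open>Center1\<close> the shorter one, by at most
  1.\<close>

definition mid where "mid i = L i div 2"

lemma mid_bounds:
  assumes "i < length s"
  shows "0 < mid i" "mid i < L i" "mid i \<le> L i - mid i" "L i - mid i \<le> mid i + 1"
  using L_ge_2[OF assms] by (auto simp: mid_def)

lemma P_mid: "i < length s \<Longrightarrow> P i (mid i) = Internal i (mid i)"
  using mid_bounds P_Internal by blast

lemma mid_in_verts: "i < length s \<Longrightarrow> Internal i (mid i) \<in> verts G"
  using mid_bounds Internal_in_verts by blast

text \<open>The halves differ by at most 1, while a detour through the other centre costs an extra
  \<open>L 0 \<ge> 2\<close>.\<close>

lemma \<delta>_centers_mid:
  assumes "i < length s"
  shows "\<delta> Center1 (Internal i (mid i)) = mid i"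
    and "\<delta> Center2 (Internal i (mid i)) = L i - mid i"
proof -
  note C = Center1_in_verts Center2_in_verts
  have "2 \<le> L 0" using nonempty by (simp add: L_ge_2)
  then show "\<delta> Center1 (Internal i (mid i)) = mid i" "\<delta> Center2 (Internal i (mid i)) = L i - mid i"
    using \<delta>_Center1[OF assms, of "mid i"] \<delta>_Center2[OF assms, of "mid i"] mid_bounds[OF assms]
      \<delta>_sym[OF C(1) mid_in_verts[OF assms]] \<delta>_sym[OF C(2) mid_in_verts[OF assms]]
    by (auto simp: P_mid[OF assms])
qed

lemma \<delta>_mid:
  assumes i: "i < length s" and j: "j \<le> L i"
  shows "\<delta> (P i j) (Internal i (mid i)) = \<bar>real j - real (mid i)\<bar>"
proof (rule antisym)
  have v: "P i j \<in> verts G" "P i (mid i) \<in> verts G"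
    using i j mid_bounds[OF i] P_in_verts by auto
  show "\<delta> (P i j) (Internal i (mid i)) \<le> \<bar>real j - real (mid i)\<bar>"
    using \<delta>_path_le[OF i, of j "mid i"] \<delta>_path_le[OF i, of "mid i" j] \<delta>_sym[OF v] j mid_bounds[OF i]
    by (cases "j \<le> mid i") (auto simp: P_mid[OF i])
  \<comment> \<open>All other paths are flattened: off path \<open>i\<close>, \<open>f\<close> takes
    only its values at the two centres, which differ by at most 1. Hence no detour off path
    \<open>i\<close> is a shortcut.\<close>
  define f where "f v = (case v of Center1 \<Rightarrow> real (mid i) | Center2 \<Rightarrow> real (L i - mid i)
    | Internal k l \<Rightarrow> if k = i then \<bar>real l - real (mid i)\<bar> else real (mid i))" for v
  have fi: "f (P i j) = \<bar>real j - real (mid i)\<bar>" if "j \<le> L i" for j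
    using that mid_bounds[OF i] by (auto simp: f_def theta_path_def L_def)
  have fk: "f (P k l) \<in> {real (mid i), real (L i - mid i)}" if "k \<noteq> i" for k l
    using that by (auto simp: f_def theta_path_def)
  have "f (P i j) - f (P i (mid i)) \<le> \<delta> (P i j) (P i (mid i))"
  proof (rule \<delta>_ge_lipschitz[OF _ v])
    fix k l assume kl: "k < length s" "l < L k"
    show "\<bar>f (P k l) - f (P k (Suc l))\<bar> \<le> 1"
    proof (cases "k = i")
      case True
      then show ?thesis using kl by (simp add: fi)
    next
      case False
      then show ?thesis using fk[of k l] fk[of k "Suc l"] mid_bounds[OF i] by auto
    qed
  qed
  then show "\<bar>real j - real (mid i)\<bar> \<le> \<delta> (P i j) (Internal i (mid i))"
    using fi[OF j] fi[of "mid i"] mid_bounds[OF i] by (simp add: P_mid[OF i])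
qed

text \<open>Via \<open>Center1\<close> the cost is at least \<open>mid i + 1\<close>, hence at least
  \<open>L i - mid i\<close>; via \<open>Center2\<close> it is at least that too. Position
  \<open>l = L k\<close>, that is \<open>Center2\<close>, is included, but \<open>Center1\<close>
  may be closer.\<close>

lemma \<delta>_mid_outside:
  assumes i: "i < length s" and k: "k < length s" "k \<noteq> i" and l: "l \<le> L k" "0 < l"
  shows "real (L i - mid i) \<le> \<delta> (P k l) (Internal i (mid i))"
proof -
  have "\<delta> (P k l) (Internal i (mid i)) = min (real l + mid i) (real (L k - l) + (L i - mid i))"
    using \<delta>_outside[OF k(1) l(1) mid_in_verts[OF i]] k \<delta>_centers_mid[OF i] by simp
  then show ?thesis using l mid_bounds[OF i] by simp
qed

definition mids where "mids = insert Center1 ((\<lambda>i. Internal i (mid i)) ` {1..<length s})"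

text \<open>Path 0 is a shortest route between the centres, so position on it equals distance from
  \<open>Center1\<close>.\<close>

lemma resolved_by_Center1:
  assumes "j \<le> L 0" "l \<le> L 0" "j \<noteq> l"
  shows "\<delta> (P 0 j) Center1 \<noteq> \<delta> (P 0 l) Center1"
  using assms \<delta>_Center1[of 0 j] \<delta>_Center1[of 0 l] nonempty by simp

text \<open>Equal distances from the midpoint force \<open>j + l = 2 * mid i \<le> L i\<close>. Then
  \<open>j\<close> is at distance \<open>j\<close> from \<open>Center1\<close>, whereas both routes
  from \<open>l\<close> are longer: \<open>l > j\<close> and
  \<open>L i - l + L 0 \<ge> j + L 0\<close>.\<close>

lemma resolved_same_path:
  assumes i: "i < length s" and j: "0 < j" and l: "j < l" "l < L i"
  shows "\<delta> (P i j) Center1 \<noteq> \<delta> (P i l) Center1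
    \<or> \<delta> (P i j) (Internal i (mid i)) \<noteq> \<delta> (P i l) (Internal i (mid i))"
proof -
  have "2 \<le> L 0" using nonempty by (simp add: L_ge_2)
  moreover have "2 * mid i \<le> L i" by (simp add: mid_def)
  ultimately show ?thesis
    using \<delta>_Center1[OF i, of j] \<delta>_Center1[OF i, of l] \<delta>_mid[OF i, of j] \<delta>_mid[OF i, of l] assms
    by auto
qed

text \<open>Interior positions lie within \<open>L i - mid i - 1\<close> of the midpoint, just below
  the bound for outside vertices.\<close>

lemma resolved_other_path:
  assumes i: "i < length s" and j: "0 < j" "j < L i"
    and k: "k < length s" "k \<noteq> i" and l: "l \<le> L k" "0 < l"
  shows "\<delta> (P i j) (Internal i (mid i)) < \<delta> (P k l) (Internal i (mid i))"
  using \<delta>_mid_outside[OF i k l] \<delta>_mid[OF i, of j] j mid_bounds[OF i] by auto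

text \<open>Both centres are counted as ends of path 0, so the other paths contribute interior
  vertices only.\<close>

lemma vert_cases:
  assumes "v \<in> verts G"
  obtains j where "j \<le> L 0" "v = P 0 j"
  | i j where "1 \<le> i" "i < length s" "0 < j" "j < L i" "v = P i j"
proof (cases v)
  case Center1
  then show thesis using that(1)[of 0] by (simp add: P_0)
next
  case Center2
  then show thesis using that(1)[of "L 0"] by (simp add: P_L)
next
  case (Internal i j)
  then show thesis
    using that(1)[of j] that(2)[of i j] assms P_Internal[of j i] Internal_in_verts[of i j]
    by (cases i) auto
qed

lemma internal_resolved:
  assumes i: "1 \<le> i" "i < length s" "0 < j" "j < L i" and v: "v \<in> verts G" "v \<noteq> P i j"
  shows "\<exists>w \<in> mids. \<delta> (P i j) w \<noteq> \<delta> v w"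
proof -
  have W: "Center1 \<in> mids" "Internal i (mid i) \<in> mids" using i by (auto simp: mids_def)
  have away: ?thesis if "k < length s" "k \<noteq> i" "l \<le> L k" "0 < l" "v = P k l" for k l
    using resolved_other_path[OF i(2-4) that(1-4)] W that(5) by (metis less_irrefl)
  from v(1) show ?thesis
  proof (cases rule: vert_cases)
    case (1 l)
    show ?thesis
    \<comment> \<open>Position 0 is \<open>Center1\<close>, which \<open>away\<close> does not
      cover; it is the only vertex at distance 0 from itself. \<open>Center2\<close> falls under
      \<open>away\<close>.\<close>
    proof (cases "l = 0")
      case True
      then have "\<delta> v Center1 = 0" using 1 \<delta>_self[OF Center1_in_verts] by (simp add: P_0)
      moreover have "\<delta> (P i j) Center1 \<noteq> 0"
        using \<delta>_Center1[OF i(2), of j] i L_ge_2[of 0] nonempty by (auto simp: min_def)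
      ultimately show ?thesis using W by metis
    next
      case False
      then show ?thesis using away[of 0 l] 1 i nonempty by auto
    qed
  next
    case (2 k l)
    show ?thesis
    proof (cases "k = i")
      case True
      then have "j < l \<or> l < j" using 2(5) v(2) by (cases j l rule: linorder_cases) auto
      then show ?thesis
        using resolved_same_path[OF i(2), of j l] resolved_same_path[OF i(2), of l j] 2 i True W
        by metis
    next
      case False
      then show ?thesis using away[of k l] 2 by simp
    qed
  qed
qed

lemma resolving_set_mids: "resolving_set G mids"
  unfolding resolving_set_def
proof (intro conjI ballI impI)
  show sub: "mids \<subseteq> verts G"
    using Center1_in_verts mid_in_verts by (auto simp: mids_def simp del: with_proj_simps)
  fix u v assume uv: "u \<in> verts G" "v \<in> verts G" "u \<noteq> v"
  have "\<exists>w \<in> mids. \<delta> u w \<noteq> \<delta> v w"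
    using uv(1)
  proof (cases rule: vert_cases)
    case u: (1 j)
    from uv(2) show ?thesis
    proof (cases rule: vert_cases)
      case (1 l)
      then show ?thesis using resolved_by_Center1[of j l] u uv(3) by (auto simp: mids_def)
    next
      case (2 i l)
      then show ?thesis using internal_resolved[of i l u] uv by metis
    qed
  next
    case (2 i j)
    then show ?thesis using internal_resolved[of i j v] uv by metis
  qed
  then obtain w where w: "w \<in> mids" "\<delta> u w \<noteq> \<delta> v w" ..
  moreover have "w \<in> verts G" using sub w(1) by (rule subsetD)
  ultimately have "resolves G w u v" using resolves_iff uv(1,2) by blast
  then show "\<exists>w \<in> mids. resolves G w u v" using w(1) ..
qed

lemma card_mids: "finite mids" "card mids \<le> length s"
proof -
  have "card ((\<lambda>i. Internal i (mid i)) ` {1..<length s}) \<le> length s - 1"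
    using card_image_le[of "{1..<length s}"] by simp
  moreover have "0 < length s" using nonempty by simp
  ultimately show "card mids \<le> length s"
    unfolding mids_def by (intro card_insert_le_m1)
  show "finite mids" by (simp add: mids_def)
qed

end

theorem theorem2:
  fixes m :: nat and s :: "nat list"
  assumes "m \<ge> 2"
    and "length s = m"
    and "sorted s"
    and "\<forall>i < m. s ! i \<ge> 1"
  shows "int m - 3 \<le> int (metric_dimension (with_proj (generalized_theta s)))
    \<and> metric_dimension (with_proj (generalized_theta s)) \<le> m"
proof -
  interpret sorted_theta s using assms by unfold_locales auto
  define R where "R k \<longleftrightarrow> (\<exists>W. finite W \<and> resolving_set G W \<and> card W = k)" for k
  have dim: "metric_dimension G = (LEAST k. R k)"
    by (simp only: metric_dimension_def R_def)
  have mids: "R (card mids)"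
    unfolding R_def using resolving_set_mids card_mids(1) by blast
  then have "R (metric_dimension G)"
    unfolding dim by (rule LeastI)
  then obtain W where W: "finite W" "resolving_set G W" "card W = metric_dimension G"
    unfolding R_def by (elim exE conjE)
  \<comment> \<open>The minimum is attained, so the lower bound applies to an optimal
    \<open>W\<close>. The additive form avoids truncated subtraction when
    \<open>m = 2\<close>.\<close>
  have "m \<le> metric_dimension G + 3"
    using resolving_set_card_ge[OF W(2,1)] W(3) assms(2) by linarith
  moreover have "metric_dimension G \<le> card mids"
    unfolding dim using mids by (rule Least_le)
  ultimately show ?thesis using card_mids(2) assms(2) by linarith
qed

end
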